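(* Let $\{z_t\},\{y_t\},\{x_t\}$ be generated by the AC-FGM algorithm (see context) applied to $\min_{x\in X}\{\Psi(x)=f(x)+h(x)\}$ with $f$ smooth, with $x_0=y_0=z_0\in X$, $\eta_1>0$ such that $x_1\ne x_0$, $\beta_1=0$, $\beta_t=\beta$ for $t\ge2$ with $\beta\in(0,1-\tfrac{\sqrt6}{3}]$. Let $\alpha$ be an absolute constant in $[0,1]$, $\tau_1=0$, $\tau_2=1$, $\eta_2=\min\{(1-\beta)\eta_1,\tfrac1{4L_1}\}$, and for $t\ge3$ $$\eta_t=\min\Big\{\tfrac43\eta_{t-1},\ \tfrac{\tau_{t-2}+1}{\tau_{t-1}}\,\eta_{t-1},\ \tfrac{\tau_{t-1}}{4L_{t-1}}\Big\},\qquad \tau_t=\tau_{t-1}+\tfrac\alpha2+\tfrac{2(1-\alpha)\eta_tL_{t-1}}{\tau_{t-1}},$$ where the $L_t$ are the local estimates defined in the context. Let $\hat L_t:=\max\{\tfrac{1}{4(1-\beta)\eta_1},L_1,\dots,L_t\}$ and $$\bar x_k:=\frac{\sum_{t=1}^{k-1}\big[(\tau_t+1)\eta_{t+1}-\tau_{t+1}\eta_{t+2}\big]x_t+(\tau_k+1)\eta_{k+1}x_k}{\sum_{t=2}^{k+1}\eta_t}.$$ Then, with $x^*$ an arbitrary point of $X^*$ and $k$ the number of iterations, $$\Psi(x_k)-\Psi(x^* )\le\frac{12\hat L_k}{(\alpha k+4-2\alpha)(\alpha k+3-2\alpha)}\Big[\tfrac1\beta\|z_0-x^*\|^2+\eta_2\Big(\tfrac{5L_1}2-\tfrac1{\eta_1}\Big)\|z_1-z_0\|^2\Big],$$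 and $$\Psi(\bar x_k)-\Psi(x^* )\le\frac{6}{\sum_{t=1}^k(3+\alpha(t-2))/\hat L_t}\Big[\tfrac1\beta\|z_0-x^*\|^2+\eta_2\Big(\tfrac{5L_1}2-\tfrac1{\eta_1}\Big)\|z_1-z_0\|^2\Big]$$ $$\le\frac{12\hat L_k}{6k+\alpha k(k-3)}\Big[\tfrac1\beta\|z_0-x^*\|^2+\eta_2\Big(\tfrac{5L_1}2-\tfrac1{\eta_1}\Big)\|z_1-z_0\|^2\Big].$$
   Context: Problem: $X\subseteq\mathbb{R}^n$ is a closed convex set, $h:X\to\mathbb{R}$ and $f:X\to\mathbb{R}$ are closed convex functions, $\Psi:=f+h$, and the set $X^*$ of minimizers of $\Psi$ over $X$ is nonempty. $\langle\cdot,\cdot\rangle$ is the Euclidean inner product and $\|\cdot\|$ the Euclidean norm. For $x\in X$, $g(x)\in\partial f(x)$ denotes the (sub)gradient returned by the first-order oracle. $f$ is smooth: there is $L>0$ (unknown to the algorithm) such that for all $x,y\in X$, $\|g(x)-g(y)\|\le L\|x-y\|$ and $$\tfrac{1}{2L}\|g(y)-g(x)\|^2\le f(y)-f(x)-\langle g(x),y-x\rangle\le\tfrac L2\|y-x\|^2 .$$ AC-FGM algorithm: starting from $z_0=y_0=x_0\in X$, for $t=1,2,\dots$ $$z_t=\arg\min_{z\in X}\big\{\eta_t[\langle g(x_{t-1}),z\rangle+h(z)]+\tfrac12\|y_{t-1}-z\|^2\big\},$$ $$y_t=(1-\beta_t)y_{t-1}+\beta_tz_t,\qquad x_t=\frac{z_t+\tau_tx_{t-1}}{1+\tau_t}.$$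 The parameters may depend on previously generated iterates. Local estimates: $L_1:=\|g(x_1)-g(x_0)\|/\|x_1-x_0\|$ (with $\eta_1$ chosen such that $x_1\ne x_0$). For $t\ge2$, with $B_t:=f(x_{t-1})-f(x_t)-\langle g(x_t),x_{t-1}-x_t\rangle\ (\ge 0)$, set $L_t:=0$ if $B_t=0$ and $L_t:=\|g(x_t)-g(x_{t-1})\|^2/(2B_t)$ if $B_t>0$. Conventions: $\tfrac00=0$ and $\tfrac a0=+\infty$ for $a>0$.
   Formalization: The bound on Ψ(x_k) is stated only for k ≥ 2: it fails at k = 1, e.g. X = ℝ, h = 0, α = 0, β = 1−√6/3, f'(u) = u for u ≤ 0 and min(10⁶u, 1000) for u ≥ 0, x_0 = −1, η_1 = 11. The bounds on Ψ(x̄_k) are stated for all k ≥ 1. *)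

theory Defs
  imports "HOL-Analysis.Analysis"
begin

text \<open>
  Functions on a set \<open>X\<close> are total functions whose values outside \<open>X\<close> are never used.
  Closedness of a function means closedness of its epigraph over \<open>X\<close>.
\<close>

definition closed_convex_on :: "'a::euclidean_space set \<Rightarrow> ('a \<Rightarrow> real) \<Rightarrow> bool" where
  "closed_convex_on X f \<longleftrightarrow> convex_on X f \<and> closed (epigraph X f)"

definition subdifferential :: "'a::euclidean_space set \<Rightarrow> ('a \<Rightarrow> real) \<Rightarrow> 'a \<Rightarrow> 'a set" where
  "subdifferential X f u = {v. \<forall>w\<in>X. f u + v \<bullet> (w - u) \<le> f w}"

definition minimizers :: "'a set \<Rightarrow> ('a \<Rightarrow> real) \<Rightarrow> 'a set" where
  "minimizers X F = {u. is_arg_min F (\<lambda>w. w \<in> X) u}"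

definition oracle_smooth ::
    "'a::euclidean_space set \<Rightarrow> ('a \<Rightarrow> real) \<Rightarrow> ('a \<Rightarrow> 'a) \<Rightarrow> real \<Rightarrow> bool" where
  "oracle_smooth X f g L \<longleftrightarrow>
     (\<forall>u\<in>X. \<forall>w\<in>X.
        norm (g u - g w) \<le> L * norm (u - w) \<and>
        1 / (2 * L) * (norm (g w - g u))\<^sup>2 \<le> f w - f u - g u \<bullet> (w - u) \<and>
        f w - f u - g u \<bullet> (w - u) \<le> L / 2 * (norm (w - u))\<^sup>2)"

text \<open>
  A run of the method is a triple of sequences related by the updates. The parameters are
  arbitrary sequences here, so they may depend on the iterates.
\<close>

definition ac_fgm ::
    "'a::euclidean_space set \<Rightarrow> ('a \<Rightarrow> real) \<Rightarrow> ('a \<Rightarrow> 'a) \<Rightarrow>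
     (nat \<Rightarrow> real) \<Rightarrow> (nat \<Rightarrow> real) \<Rightarrow> (nat \<Rightarrow> real) \<Rightarrow>
     (nat \<Rightarrow> 'a) \<Rightarrow> (nat \<Rightarrow> 'a) \<Rightarrow> (nat \<Rightarrow> 'a) \<Rightarrow> bool" where
  "ac_fgm X h g \<eta> \<beta> \<tau> z y x \<longleftrightarrow>
     x 0 \<in> X \<and> y 0 = x 0 \<and> z 0 = x 0 \<and>
     (\<forall>t\<ge>1.
        is_arg_min (\<lambda>u. \<eta> t * (g (x (t - 1)) \<bullet> u + h u) + 1 / 2 * (norm (y (t - 1) - u))\<^sup>2)
          (\<lambda>u. u \<in> X) (z t) \<and>
        y t = (1 - \<beta> t) *\<^sub>R y (t - 1) + \<beta> t *\<^sub>R z t \<and>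
        x t = (z t + \<tau> t *\<^sub>R x (t - 1)) /\<^sub>R (1 + \<tau> t))"

definition lin_gap ::
    "('a::euclidean_space \<Rightarrow> real) \<Rightarrow> ('a \<Rightarrow> 'a) \<Rightarrow> (nat \<Rightarrow> 'a) \<Rightarrow> nat \<Rightarrow> real" where
  "lin_gap f g x t = f (x (t - 1)) - f (x t) - g (x t) \<bullet> (x (t - 1) - x t)"

text \<open>The value at index 0 is irrelevant.\<close>

definition local_L ::
    "('a::euclidean_space \<Rightarrow> real) \<Rightarrow> ('a \<Rightarrow> 'a) \<Rightarrow> (nat \<Rightarrow> 'a) \<Rightarrow> nat \<Rightarrow> real" where
  "local_L f g x t =
     (if t = 1 then norm (g (x 1) - g (x 0)) / norm (x 1 - x 0)
      else if lin_gap f g x t = 0 then 0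
      else (norm (g (x t) - g (x (t - 1))))\<^sup>2 / (2 * lin_gap f g x t))"

text \<open>
  The local estimates \<open>L t\<close> can vanish, and then the corresponding term of the minimum is
  \<open>\<infinity>\<close>. The minima are therefore taken in \<^typ>\<open>ereal\<close>, where \<open>0 / 0 = 0\<close>
  and \<open>a / 0 = \<infinity>\<close> for \<open>a > 0\<close>, whereas \<open>a / 0 = 0\<close> in \<^typ>\<open>real\<close>.
\<close>

definition ac_fgm_params ::
    "real \<Rightarrow> real \<Rightarrow> (nat \<Rightarrow> real) \<Rightarrow> (nat \<Rightarrow> real) \<Rightarrow> (nat \<Rightarrow> real) \<Rightarrow> (nat \<Rightarrow> real) \<Rightarrow> bool" where
  "ac_fgm_params \<alpha> \<beta> L \<eta> \<beta>s \<tau> \<longleftrightarrow>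
     \<beta>s 1 = 0 \<and> (\<forall>t\<ge>2. \<beta>s t = \<beta>) \<and>
     \<tau> 1 = 0 \<and> \<tau> 2 = 1 \<and>
     ereal (\<eta> 2) = min (ereal ((1 - \<beta>) * \<eta> 1)) (1 / ereal (4 * L 1)) \<and>
     (\<forall>t\<ge>3.
        ereal (\<eta> t) =
          min (ereal (4 / 3 * \<eta> (t - 1)))
            (min (ereal ((\<tau> (t - 2) + 1) / \<tau> (t - 1) * \<eta> (t - 1)))
              (ereal (\<tau> (t - 1)) / ereal (4 * L (t - 1)))) \<and>
        \<tau> t = \<tau> (t - 1) + \<alpha> / 2 + 2 * (1 - \<alpha>) * \<eta> t * L (t - 1) / \<tau> (t - 1))"

definition L_hat :: "real \<Rightarrow> (nat \<Rightarrow> real) \<Rightarrow> (nat \<Rightarrow> real) \<Rightarrow> nat \<Rightarrow> real" where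
  "L_hat \<beta> \<eta> L t = Max (insert (1 / (4 * (1 - \<beta>) * \<eta> 1)) (L ` {1..t}))"

definition x_bar ::
    "(nat \<Rightarrow> real) \<Rightarrow> (nat \<Rightarrow> real) \<Rightarrow> (nat \<Rightarrow> 'a::euclidean_space) \<Rightarrow> nat \<Rightarrow> 'a" where
  "x_bar \<eta> \<tau> x k =
     ((\<Sum>t = 1..k - 1. ((\<tau> t + 1) * \<eta> (t + 1) - \<tau> (t + 1) * \<eta> (t + 2)) *\<^sub>R x t)
        + ((\<tau> k + 1) * \<eta> (k + 1)) *\<^sub>R x k)
     /\<^sub>R (\<Sum>t = 2..k + 1. \<eta> t)"

end

theory Submission
  imports Defs
begin

text \<open>
  The optimality conditions of \<open>z (t + 1)\<close> (tested at \<open>xstar\<close>) and of \<open>z t\<close> (tested at \<open>z (t + 1)\<close>,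
  scaled by \<open>\<eta> (t + 1) / \<eta> t\<close>) add up to a recursion for the gaps \<open>\<Psi> (x t) - \<Psi> xstar\<close>.
  The gradient error in it is absorbed by \<open>\<eta> (t + 1) * \<tau> t * lin_gap f g x t\<close> up to
  \<open>(norm (z (t + 1) - z t))\<^sup>2 / 8\<close>. With \<open>u = z (t + 1) - y t\<close> and \<open>v = z t - y t\<close> the
  remaining quadratic form in \<open>u, v\<close> dominates \<open>((norm u)\<^sup>2 - (norm v)\<^sup>2) / 4\<close>, and \<open>norm v\<close> is at
  most the previous \<open>norm u\<close>. So
  \<open>(norm (y t - xstar))\<^sup>2 / (2 * \<beta>) + (norm (z t - y (t - 1)))\<^sup>2 / 4\<close>
  is a potential for the recursion, and summation bounds the weighted gaps by \<open>R / 2\<close>. The rates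
  follow from \<open>(3 + \<alpha> * (t - 2)) / (12 * Lh t) \<le> \<eta> (t + 1)\<close>, proved by induction together with
  \<open>1 + \<alpha> * (t - 2) / 2 \<le> \<tau> t \<le> t / 2\<close>.
\<close>

section \<open>Optimality of the prox step and quadratic estimates\<close>

text \<open>Compare \<open>z\<close> with the point at fraction \<open>s\<close> of the segment from
  \<open>z\<close> to \<open>w\<close>. After division by \<open>s\<close> the quadratic term still
  carries a factor \<open>s\<close>, so it vanishes as \<open>s\<close> tends to 0.\<close>

lemma prox_optimality:
  fixes h :: "'a::euclidean_space \<Rightarrow> real"
  assumes h: "convex_on X h" and e: "0 \<le> e"
    and z: "is_arg_min (\<lambda>u. e * (v \<bullet> u + h u) + 1 / 2 * (norm (p - u))\<^sup>2) (\<lambda>u. u \<in> X) z"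
    and w: "w \<in> X"
  shows "e * (v \<bullet> (z - w) + h z - h w) \<le> (p - z) \<bullet> (z - w)"
proof -
  define A where "A = e * (v \<bullet> (w - z) + h w - h z) - (p - z) \<bullet> (w - z)"
  define N where "N = (w - z) \<bullet> (w - z)"
  have zX: "z \<in> X" using z by (simp add: is_arg_min_def)
  have X: "convex X" using h by (simp add: convex_on_def)
  have A: "0 \<le> A + s * N / 2" if s: "0 < s" "s \<le> 1" for s
  proof -
    define q where "q = (1 - s) *\<^sub>R z + s *\<^sub>R w"
    have qX: "q \<in> X" using X zX w s by (auto simp: q_def convex_def)
    have q': "q = z + s *\<^sub>R (w - z)" by (simp add: q_def algebra_simps)
    have hq: "h q \<le> (1 - s) * h z + s * h w"
      using convex_onD[OF h, of s z w] s zX w by (simp add: q_def)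
    have "e * (v \<bullet> z + h z) + 1 / 2 * (norm (p - z))\<^sup>2
        \<le> e * (v \<bullet> q + h q) + 1 / 2 * (norm (p - q))\<^sup>2"
      using z qX by (force simp: is_arg_min_def)
    also have "\<dots> \<le> e * (v \<bullet> q + ((1 - s) * h z + s * h w)) + 1 / 2 * (norm (p - q))\<^sup>2"
      using hq e by (simp add: mult_left_mono)
    also have "v \<bullet> q = v \<bullet> z + s * (v \<bullet> (w - z))"
      by (simp add: q' inner_add_right)
    also have "(norm (p - q))\<^sup>2 = (norm (p - z))\<^sup>2 - 2 * s * ((p - z) \<bullet> (w - z)) + s\<^sup>2 * N"
    proof -
      have pq: "p - q = (p - z) - s *\<^sub>R (w - z)" by (simp add: q')
      show ?thesis unfolding pq
        by (simp only: power2_norm_eq_inner N_def)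
          (simp add: inner_diff_left inner_diff_right inner_commute power2_eq_square algebra_simps)
    qed
    finally have "0 \<le> s * (A + s * N / 2)"
      by (simp add: A_def power2_eq_square algebra_simps)
    then show ?thesis using s by (simp add: zero_le_mult_iff)
  qed
  have "0 \<le> A"
  proof (rule tendsto_lowerbound)
    show "((\<lambda>s. A + s * N / 2) \<longlongrightarrow> A) (at_right 0)"
      by (auto intro!: tendsto_eq_intros)
    show "\<forall>\<^sub>F s in at_right 0. 0 \<le> A + s * N / 2"
      using A unfolding eventually_at_right[OF zero_less_one] by (intro exI[of _ 1]) auto
  qed simp
  then show ?thesis
    by (simp add: A_def inner_diff_right algebra_simps)
qed

lemma convex_combination_norm_sq:
  fixes p z w :: "'a::real_inner"
  shows "(norm ((1 - b) *\<^sub>R p + b *\<^sub>R z - w))\<^sup>2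
    = (1 - b) * (norm (p - w))\<^sup>2 + b * (norm (z - w))\<^sup>2 - b * (1 - b) * (norm (z - p))\<^sup>2"
  by (simp only: power2_norm_eq_inner)
    (simp add: inner_diff_left inner_diff_right inner_add_left inner_add_right inner_commute
      power2_eq_square algebra_simps)

text \<open>Expand \<open>w - p\<close> around \<open>z\<close>, then eliminate
  \<open>(norm (z - w))\<^sup>2\<close> through the averaged point. With \<open>p = y t\<close> and
  that point equal to \<open>y (t + 1)\<close>, the two distances to \<open>w\<close>
  telescope.\<close>

lemma prox_averaging_identity:
  fixes p z w :: "'a::real_inner"
  assumes b: "0 < b"
  shows "(p - z) \<bullet> (z - w)
    = 1 / (2 * b) * (norm (p - w))\<^sup>2 - 1 / (2 * b) * (norm ((1 - b) *\<^sub>R p + b *\<^sub>R z - w))\<^sup>2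
      - (1 - b / 2) * (norm (z - p))\<^sup>2"
proof -
  have "(norm (p - w))\<^sup>2 = (norm (z - p))\<^sup>2 + 2 * ((p - z) \<bullet> (z - w)) + (norm (z - w))\<^sup>2"
    by (simp only: power2_norm_eq_inner)
      (simp add: inner_diff_left inner_diff_right inner_commute algebra_simps)
  then have p: "(p - z) \<bullet> (z - w)
      = ((norm (p - w))\<^sup>2 - (norm (z - p))\<^sup>2 - (norm (z - w))\<^sup>2) / 2" by simp
  show ?thesis
    unfolding p convex_combination_norm_sq using b by (simp add: field_simps power2_eq_square)
qed

text \<open>Completing the square with \<open>u - (c - 1 / 4) *\<^sub>R v\<close> leaves the scalar
  condition \<open>(c - 1 / 4)\<^sup>2 \<le> 2 * (c + 1 / 8)\<close>, for which
  \<open>c \<le> 2\<close> suffices.\<close>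

lemma inner_quadratic_form_nonneg:
  fixes u v :: "'a::real_inner"
  assumes "0 \<le> c" "c \<le> 2"
  shows "(c - 1 / 4) * (u \<bullet> v) \<le> 1 / 2 * (norm u)\<^sup>2 + (c + 1 / 8) * (norm v)\<^sup>2"
proof -
  have "0 \<le> (norm (u - (c - 1 / 4) *\<^sub>R v))\<^sup>2" by simp
  also have "\<dots> = (norm u)\<^sup>2 - 2 * ((c - 1 / 4) * (u \<bullet> v)) + (c - 1 / 4)\<^sup>2 * (norm v)\<^sup>2"
    by (simp only: power2_norm_eq_inner)
      (simp add: inner_diff_left inner_diff_right inner_commute power2_eq_square algebra_simps)
  finally have 1: "2 * ((c - 1 / 4) * (u \<bullet> v)) \<le> (norm u)\<^sup>2 + (c - 1 / 4)\<^sup>2 * (norm v)\<^sup>2"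
    by simp
  have "c * c \<le> c * 2" using assms by (intro mult_left_mono) auto
  then have "(c - 1 / 4)\<^sup>2 \<le> 2 * (c + 1 / 8)"
    using assms by (simp add: power2_eq_square algebra_simps)
  then have "(c - 1 / 4)\<^sup>2 * (norm v)\<^sup>2 \<le> 2 * (c + 1 / 8) * (norm v)\<^sup>2"
    by (intro mult_right_mono) auto
  with 1 show ?thesis by (simp add: algebra_simps)
qed

text \<open>From \<open>b \<le> 1 / 4\<close> the coefficient of \<open>(norm u)\<^sup>2\<close> on
  the right is at least 7/8. Taking off 1/8 for the gradient error and 1/4 for the potential leaves
  1/2, the coefficient in the quadratic form above.\<close>

lemma potential_step:
  fixes u v :: "'a::real_inner"
  assumes c: "0 \<le> c" "c \<le> 2" and b: "b \<le> 1 / 4"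
  shows "(norm (u - v))\<^sup>2 / 8 + 1 / 4 * (norm u)\<^sup>2 - 1 / 4 * (norm v)\<^sup>2
    \<le> (1 - b / 2) * (norm u)\<^sup>2 - c * (u \<bullet> v) + c * (norm v)\<^sup>2"
proof -
  have uv: "(norm (u - v))\<^sup>2 = (norm u)\<^sup>2 - 2 * (u \<bullet> v) + (norm v)\<^sup>2"
    by (simp only: power2_norm_eq_inner)
      (simp add: inner_diff_left inner_diff_right inner_commute algebra_simps)
  have "7 / 8 * (norm u)\<^sup>2 \<le> (1 - b / 2) * (norm u)\<^sup>2"
    using b by (intro mult_right_mono) auto
  then show ?thesis
    using inner_quadratic_form_nonneg[OF c, of u v] unfolding uv
    by (simp add: algebra_simps add_divide_distrib diff_divide_distrib)
qed

text \<open>In the first step the gradient error is controlled by a Lipschitz bound instead of a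
  curvature identity. The terms in \<open>v\<close> that cannot be absorbed stay on the left and
  later become the second summand of \<open>bound\<close>.\<close>

lemma potential_first_step:
  fixes u v d :: "'a::real_inner"
  assumes c: "0 \<le> c" "c \<le> 1 - b" and e: "0 \<le> e" "0 \<le> l" "4 * e * l \<le> 1"
    and d: "norm d \<le> l * norm v"
  shows "1 / 4 * (norm u)\<^sup>2 - e * (d \<bullet> (u - v)) + c / 2 * (norm v)\<^sup>2 - 5 / 4 * e * l * (norm v)\<^sup>2
    \<le> (1 - b / 2) * (norm u)\<^sup>2 - c * (u \<bullet> v) + c * (norm v)\<^sup>2"
proof -
  have "- (d \<bullet> (u - v)) \<le> norm d * norm (u - v)"
    using Cauchy_Schwarz_ineq2[of d "u - v"] by linarith
  also have "\<dots> \<le> (l * norm v) * (norm u + norm v)"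
    using d e norm_triangle_ineq4[of u v] by (intro mult_mono) auto
  also have "\<dots> = l * (norm v * norm u + (norm v)\<^sup>2)"
    by (simp add: algebra_simps power2_eq_square)
  also have "\<dots> \<le> l * ((norm u)\<^sup>2 + 5 / 4 * (norm v)\<^sup>2)"
  proof (intro mult_left_mono e)
    \<comment> \<open>This weighting keeps coefficient 1 on \<open>(norm u)\<^sup>2\<close>, which
      \<open>4 * e * l \<le> 1\<close> turns into 1/4; it is the origin of 5/4, hence of
      \<open>5 * L 1 / 2\<close> in the rates.\<close>
    have "0 \<le> (norm u - norm v / 2)\<^sup>2" by simp
    then show "norm v * norm u + (norm v)\<^sup>2 \<le> (norm u)\<^sup>2 + 5 / 4 * (norm v)\<^sup>2"
      by (simp add: power2_eq_square algebra_simps)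
  qed
  finally have "e * - (d \<bullet> (u - v)) \<le> e * (l * ((norm u)\<^sup>2 + 5 / 4 * (norm v)\<^sup>2))"
    using e by (intro mult_left_mono)
  moreover have "e * l * (norm u)\<^sup>2 \<le> 1 / 4 * (norm u)\<^sup>2"
    using e by (intro mult_right_mono) auto
  ultimately have 1: "- (e * (d \<bullet> (u - v))) \<le> 1 / 4 * (norm u)\<^sup>2 + 5 / 4 * e * l * (norm v)\<^sup>2"
    by (simp add: algebra_simps)
  have "0 \<le> c / 2 * (norm (u - v))\<^sup>2" using c by simp
  also have "(norm (u - v))\<^sup>2 = (norm u)\<^sup>2 - 2 * (u \<bullet> v) + (norm v)\<^sup>2"
    by (simp only: power2_norm_eq_inner)
      (simp add: inner_diff_left inner_diff_right inner_commute algebra_simps)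
  finally have 2: "c * (u \<bullet> v) \<le> c / 2 * (norm u)\<^sup>2 + c / 2 * (norm v)\<^sup>2"
    by (simp add: algebra_simps)
  \<comment> \<open>The budget \<open>1 - b / 2\<close> is spent exactly: 1/4 on the potential, 1/4
    on the gradient error and \<open>(1 - b) / 2\<close> on the cross term.\<close>
  have "c / 2 * (norm u)\<^sup>2 \<le> (1 - b) / 2 * (norm u)\<^sup>2"
    using c by (intro mult_right_mono) auto
  with 1 2 show ?thesis by (simp add: algebra_simps diff_divide_distrib)
qed

text \<open>Young's inequality with weight \<open>4 * e\<close>; the identity for \<open>d\<close>
  trades its square for \<open>B\<close>, and the step size condition bounds the resulting factor by
  \<open>s\<close>.\<close>

lemma gradient_error_bound:
  fixes d w :: "'a::real_inner"
  assumes d: "(norm d)\<^sup>2 = 2 * l * B" and B: "0 \<le> B" and e: "0 \<le> e" "4 * e * l \<le> s"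
  shows "- (e * (d \<bullet> w)) \<le> e * s * B + (norm w)\<^sup>2 / 8"
proof -
  have "0 \<le> (norm ((4 * e) *\<^sub>R d + w))\<^sup>2" by simp
  also have "\<dots> = 16 * e\<^sup>2 * (norm d)\<^sup>2 + 8 * (e * (d \<bullet> w)) + (norm w)\<^sup>2"
    by (simp only: power2_norm_eq_inner)
      (simp add: inner_add_left inner_add_right inner_commute power2_eq_square algebra_simps)
  also have "16 * e\<^sup>2 * (norm d)\<^sup>2 = 8 * (e * B * (4 * e * l))"
    unfolding d by (simp add: power2_eq_square)
  also have "e * B * (4 * e * l) \<le> e * B * s"
    using B e by (intro mult_left_mono) auto
  finally show ?thesis by (simp add: algebra_simps)
qed

text \<open>Clearing the denominator is sound even for \<open>l = 0\<close>: the quotient is then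
  infinite and the product condition holds since \<open>0 < s\<close>. Taking \<open>b = e\<close>
  yields upper bounds on a step size; the converse direction proves lower bounds.\<close>

lemma le_ereal_min_divide_iff:
  assumes "0 < s" "0 \<le> l" and e: "ereal e = min (ereal a) (ereal s / ereal (4 * l))"
  shows "b \<le> e \<longleftrightarrow> b \<le> a \<and> 4 * b * l \<le> s"
proof -
  have "b \<le> e \<longleftrightarrow> ereal b \<le> ereal e" by simp
  also have "\<dots> \<longleftrightarrow> b \<le> a \<and> ereal b \<le> ereal s / ereal (4 * l)" unfolding e by simp
  also have "ereal b \<le> ereal s / ereal (4 * l) \<longleftrightarrow> 4 * b * l \<le> s"
    using assms(1,2) by (cases "l = 0") (auto simp: divide_ereal_def field_simps)
  finally show ?thesis .
qed

section \<open>Elementary facts about a run\<close>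

locale ac_fgm_run =
  fixes X :: "'a::euclidean_space set"
    and f h :: "'a \<Rightarrow> real" and g :: "'a \<Rightarrow> 'a"
    and z y x :: "nat \<Rightarrow> 'a" and \<eta> \<beta>s \<tau> :: "nat \<Rightarrow> real"
    and \<alpha> \<beta> M :: real and xstar :: 'a
  assumes X: "convex X"
    and f: "convex_on X f" and h: "convex_on X h"
    and xstar: "xstar \<in> minimizers X (\<lambda>u. f u + h u)"
    and subgrad: "\<And>u. u \<in> X \<Longrightarrow> g u \<in> subdifferential X f u"
    and M: "0 < M" "oracle_smooth X f g M"
    and run: "ac_fgm X h g \<eta> \<beta>s \<tau> z y x"
    and alpha: "0 \<le> \<alpha>" "\<alpha> \<le> 1"
    and beta: "0 < \<beta>" "\<beta> \<le> 1 / 4"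
    and eta1: "\<eta> 1 > 0" "x 1 \<noteq> x 0"
    and params: "ac_fgm_params \<alpha> \<beta> (local_L f g x) \<eta> \<beta>s \<tau>"
begin

abbreviation "L \<equiv> local_L f g x"
abbreviation "Lh \<equiv> L_hat \<beta> \<eta> L"
abbreviation "gap u \<equiv> (f u + h u) - (f xstar + h xstar)"

lemma xstar_in: "xstar \<in> X" and gap_nonneg: "u \<in> X \<Longrightarrow> 0 \<le> gap u"
  using xstar by (force simp: minimizers_def is_arg_min_def)+

lemma beta1: "\<beta>s 1 = 0" and betas: "2 \<le> t \<Longrightarrow> \<beta>s t = \<beta>"
  and tau1: "\<tau> 1 = 0" and tau2: "\<tau> 2 = 1"
  using params by (auto simp: ac_fgm_params_def)

lemma init: "x 0 \<in> X" "y 0 = x 0" "z 0 = x 0"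
  using run by (auto simp: ac_fgm_def)

lemma
  assumes "1 \<le> t"
  shows z_argmin: "is_arg_min (\<lambda>u. \<eta> t * (g (x (t - 1)) \<bullet> u + h u)
      + 1 / 2 * (norm (y (t - 1) - u))\<^sup>2) (\<lambda>u. u \<in> X) (z t)"
    and z_in: "z t \<in> X"
    and y_eq: "y t = (1 - \<beta>s t) *\<^sub>R y (t - 1) + \<beta>s t *\<^sub>R z t"
    and x_eq: "x t = (z t + \<tau> t *\<^sub>R x (t - 1)) /\<^sub>R (1 + \<tau> t)"
proof -
  show "is_arg_min (\<lambda>u. \<eta> t * (g (x (t - 1)) \<bullet> u + h u)
      + 1 / 2 * (norm (y (t - 1) - u))\<^sup>2) (\<lambda>u. u \<in> X) (z t)"
    and "y t = (1 - \<beta>s t) *\<^sub>R y (t - 1) + \<beta>s t *\<^sub>R z t"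
    and "x t = (z t + \<tau> t *\<^sub>R x (t - 1)) /\<^sub>R (1 + \<tau> t)"
    using run assms unfolding ac_fgm_def by blast+
  then show "z t \<in> X" by (simp add: is_arg_min_def)
qed

lemma Lh_first_le: "1 / (4 * (1 - \<beta>) * \<eta> 1) \<le> Lh t"
  by (simp add: L_hat_def)

lemma Lh_pos: "0 < Lh t"
proof -
  have "0 < 1 / (4 * (1 - \<beta>) * \<eta> 1)" using beta eta1 by simp
  then show ?thesis using Lh_first_le[of t] by linarith
qed

lemma L_le_Lh: "1 \<le> t \<Longrightarrow> L t \<le> Lh t"
  unfolding L_hat_def by (rule Max_ge) auto

lemma Lh_mono: "s \<le> t \<Longrightarrow> Lh s \<le> Lh t"
  unfolding L_hat_def by (intro Max_mono) auto

lemma smooth_lower: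
  assumes u: "u \<in> X" and w: "w \<in> X"
  shows "1 / (2 * M) * (norm (g w - g u))\<^sup>2 \<le> f w - f u - g u \<bullet> (w - u)"
  using M(2) u w unfolding oracle_smooth_def by blast

text \<open>The iterates stay in \<open>X\<close> only once \<open>\<tau>\<close> is known to be nonnegative, while the sign of the
  local estimates, on which \<open>\<tau>\<close> depends, needs the iterates to be in \<open>X\<close>; hence the
  nonnegativity of \<open>\<tau>\<close> up to \<open>t\<close> as a premise.\<close>

lemma x_in_if:
  assumes "\<And>s. 1 \<le> s \<Longrightarrow> s \<le> t \<Longrightarrow> 0 \<le> \<tau> s"
  shows "x t \<in> X"
  using assms
proof (induction t)
  case 0
  then show ?case using init by simp
next
  case (Suc t)
  have \<tau>: "0 \<le> \<tau> (Suc t)" using Suc.prems by auto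
  have xt: "x t \<in> X" using Suc by auto
  have "x (Suc t) = (1 / (1 + \<tau> (Suc t))) *\<^sub>R z (Suc t) + (\<tau> (Suc t) / (1 + \<tau> (Suc t))) *\<^sub>R x t"
    using x_eq[of "Suc t"] by (simp add: scaleR_add_right divide_inverse_commute)
  moreover have "1 / (1 + \<tau> (Suc t)) + \<tau> (Suc t) / (1 + \<tau> (Suc t)) = 1"
    using \<tau> by (simp add: add_divide_distrib[symmetric])
  ultimately show ?case
    using convexD[OF X z_in[of "Suc t"] xt, of "1 / (1 + \<tau> (Suc t))" "\<tau> (Suc t) / (1 + \<tau> (Suc t))"] \<tau>
    by simp
qed

lemma local_L_nonneg_if:
  assumes "1 \<le> t" "x t \<in> X" "x (t - 1) \<in> X"
  shows "0 \<le> L t"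
proof (cases "t = 1")
  case False
  have "0 \<le> 1 / (2 * M) * (norm (g (x (t - 1)) - g (x t)))\<^sup>2" using M by simp
  also have "\<dots> \<le> lin_gap f g x t"
    using smooth_lower[OF assms(2,3)] by (simp add: lin_gap_def)
  finally show ?thesis by (simp add: local_L_def)
qed (simp add: local_L_def)

text \<open>If the linearization gap is zero, the smoothness lower bound forces the two gradients to
  agree, so the defining quotient of \<open>L t\<close> can be multiplied out in both cases.\<close>

lemma local_L_gap_if:
  assumes t: "2 \<le> t" and X: "x t \<in> X" "x (t - 1) \<in> X"
  shows "0 \<le> lin_gap f g x t"
    and "(norm (g (x t) - g (x (t - 1))))\<^sup>2 = 2 * L t * lin_gap f g x t"
proof -
  have 1: "1 / (2 * M) * (norm (g (x (t - 1)) - g (x t)))\<^sup>2 \<le> lin_gap f g x t"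
    using smooth_lower[OF X] by (simp add: lin_gap_def)
  moreover have "0 \<le> 1 / (2 * M) * (norm (g (x (t - 1)) - g (x t)))\<^sup>2" using M by simp
  ultimately show "0 \<le> lin_gap f g x t" by linarith
  show "(norm (g (x t) - g (x (t - 1))))\<^sup>2 = 2 * L t * lin_gap f g x t"
  proof (cases "lin_gap f g x t = 0")
    case True
    then have "(norm (g (x (t - 1)) - g (x t)))\<^sup>2 \<le> 0"
      using 1 M by (simp add: field_simps mult_le_0_iff)
    then show ?thesis using True by simp
  next
    case False
    then show ?thesis using t by (simp add: local_L_def)
  qed
qed

section \<open>Bounds on the step sizes and on \<open>\<tau>\<close>\<close>

lemma le_eta2_iff: "b \<le> \<eta> 2 \<longleftrightarrow> b \<le> (1 - \<beta>) * \<eta> 1 \<and> 4 * b * L 1 \<le> 1"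
proof (rule le_ereal_min_divide_iff)
  show "ereal (\<eta> 2) = min (ereal ((1 - \<beta>) * \<eta> 1)) (ereal 1 / ereal (4 * L 1))"
    using params unfolding ac_fgm_params_def by (simp add: one_ereal_def)
qed (simp_all add: local_L_def)

lemma le_eta_iff_if:
  assumes t: "3 \<le> t" and \<tau>: "0 < \<tau> (t - 1)" and L: "0 \<le> L (t - 1)"
  shows "b \<le> \<eta> t \<longleftrightarrow> b \<le> 4 / 3 * \<eta> (t - 1) \<and> b \<le> (\<tau> (t - 2) + 1) / \<tau> (t - 1) * \<eta> (t - 1)
    \<and> 4 * b * L (t - 1) \<le> \<tau> (t - 1)"
proof -
  have "b \<le> \<eta> t \<longleftrightarrow> b \<le> min (4 / 3 * \<eta> (t - 1)) ((\<tau> (t - 2) + 1) / \<tau> (t - 1) * \<eta> (t - 1))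
    \<and> 4 * b * L (t - 1) \<le> \<tau> (t - 1)"
  proof (rule le_ereal_min_divide_iff[OF \<tau> L])
    have "ereal (\<eta> t) = min (ereal (4 / 3 * \<eta> (t - 1)))
            (min (ereal ((\<tau> (t - 2) + 1) / \<tau> (t - 1) * \<eta> (t - 1)))
              (ereal (\<tau> (t - 1)) / ereal (4 * L (t - 1))))"
      using params t unfolding ac_fgm_params_def by blast
    then show "ereal (\<eta> t) = min (ereal (min (4 / 3 * \<eta> (t - 1))
        ((\<tau> (t - 2) + 1) / \<tau> (t - 1) * \<eta> (t - 1)))) (ereal (\<tau> (t - 1)) / ereal (4 * L (t - 1)))"
      by (simp only: min.assoc ereal_min)
  qed
  then show ?thesis by (simp only: min.bounded_iff conj_assoc)
qed

lemma tau_step: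
  "3 \<le> t \<Longrightarrow> \<tau> t = \<tau> (t - 1) + \<alpha> / 2 + 2 * (1 - \<alpha>) * \<eta> t * L (t - 1) / \<tau> (t - 1)"
  using params unfolding ac_fgm_params_def by blast

text \<open>The entries \<open>1 / (4 * (1 - \<beta>) * \<eta> 1)\<close> and \<open>L 1\<close> of
  the maximum \<open>Lh t\<close> match the two terms of the minimum defining
  \<open>\<eta> 2\<close>.\<close>

lemma eta2_ge: "1 / (4 * Lh t) \<le> \<eta> 2" if "1 \<le> t"
proof (subst le_eta2_iff, intro conjI)
  have "1 / (4 * (1 - \<beta>) * \<eta> 1) \<le> Lh t" by (rule Lh_first_le)
  then show "1 / (4 * Lh t) \<le> (1 - \<beta>) * \<eta> 1"
    using Lh_pos[of t] beta eta1 by (simp add: field_simps)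
  have "L 1 \<le> Lh t" using L_le_Lh[of 1] Lh_mono[OF that] by linarith
  then show "4 * (1 / (4 * Lh t)) * L 1 \<le> 1" using Lh_pos[of t] by simp
qed

text \<open>The claims need each other: nonnegative \<open>\<tau>\<close> keeps the iterates in
  \<open>X\<close> and so makes \<open>L\<close> nonnegative, the lower bound on
  \<open>\<tau>\<close> serves the curvature term of the minimum, and the upper bound serves the
  ratio term.\<close>

lemma parameter_bounds:
  assumes "2 \<le> n"
  shows "(\<forall>s. 1 \<le> s \<and> s \<le> n \<longrightarrow> 0 \<le> \<tau> s) \<and>
    1 + \<alpha> * (real n - 2) / 2 \<le> \<tau> n \<and> \<tau> n \<le> real n / 2 \<and>
    (3 + \<alpha> * (real n - 2)) / (12 * Lh n) \<le> \<eta> (n + 1)"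
  using assms
proof (induction n rule: nat_induct_at_least)
  case base
  have s: "s = 1 \<or> s = 2" if "1 \<le> s" "s \<le> 2" for s :: nat using that by auto
  have \<tau>: "\<forall>s. 1 \<le> s \<and> s \<le> 2 \<longrightarrow> 0 \<le> \<tau> s" using s tau1 tau2 by (metis order_refl zero_le_one)
  have L: "0 \<le> L 2" using \<tau> by (intro local_L_nonneg_if x_in_if) auto
  have "3 / (12 * Lh 2) \<le> \<eta> (2 + 1)"
  proof (subst le_eta_iff_if)
    have 1: "1 / (4 * Lh 2) \<le> \<eta> 2" by (rule eta2_ge) simp
    moreover have "0 < 1 / (4 * Lh 2)" using Lh_pos by simp
    ultimately have "3 / (12 * Lh 2) \<le> 4 / 3 * \<eta> 2" "3 / (12 * Lh 2) \<le> \<eta> 2"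
      by linarith+
    moreover have "4 * (3 / (12 * Lh 2)) * L 2 \<le> 1" using L_le_Lh[of 2] Lh_pos[of 2] by simp
    ultimately show "3 / (12 * Lh 2) \<le> 4 / 3 * \<eta> (2 + 1 - 1) \<and>
      3 / (12 * Lh 2) \<le> (\<tau> (2 + 1 - 2) + 1) / \<tau> (2 + 1 - 1) * \<eta> (2 + 1 - 1) \<and>
      4 * (3 / (12 * Lh 2)) * L (2 + 1 - 1) \<le> \<tau> (2 + 1 - 1)"
      using tau1 tau2 by simp
  qed (use tau2 L in auto)
  then show ?case using \<tau> tau2 by simp
next
  case (Suc n)
  define r where "r = real n"
  have r: "2 \<le> r" using Suc.hyps by (simp add: r_def)
  have IH: "\<And>s. 1 \<le> s \<Longrightarrow> s \<le> n \<Longrightarrow> 0 \<le> \<tau> s" "1 + \<alpha> * (r - 2) / 2 \<le> \<tau> n"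
    "\<tau> n \<le> r / 2" "(3 + \<alpha> * (r - 2)) / (12 * Lh n) \<le> \<eta> (n + 1)"
    using Suc.IH by (auto simp: r_def)
  have ar: "0 \<le> \<alpha> * (r - 2)" using alpha r by simp
  have ar1: "0 \<le> \<alpha> * (r - 1)" using alpha r by simp
  have \<tau>n: "1 \<le> \<tau> n" using IH(2) ar by linarith
  have Ln: "0 \<le> L n" using IH(1) Suc.hyps by (intro local_L_nonneg_if x_in_if) auto
  have "0 < (3 + \<alpha> * (r - 2)) / (12 * Lh n)" using ar Lh_pos[of n] by simp
  then have \<eta>: "0 < \<eta> (n + 1)" using IH(4) by linarith
  have eL: "4 * \<eta> (n + 1) * L n \<le> \<tau> n"
    using le_eta_iff_if[of "n + 1" "\<eta> (n + 1)"] \<tau>n Ln Suc.hyps by simp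
  \<comment> \<open>The curvature term of the minimum keeps \<open>q\<close> at most 1/4, so
    \<open>\<tau>\<close> grows by at most
    \<open>\<alpha> / 2 + (1 - \<alpha>) / 2 = 1 / 2\<close>.\<close>
  define q where "q = \<eta> (n + 1) * L n / \<tau> n"
  have q: "0 \<le> q" "q \<le> 1 / 4"
    using \<eta> Ln \<tau>n eL by (auto simp: q_def field_simps)
  have \<tau>S: "\<tau> (n + 1) = \<tau> n + \<alpha> / 2 + 2 * ((1 - \<alpha>) * q)"
    using tau_step[of "n + 1"] Suc.hyps by (simp add: q_def)
  have aq: "0 \<le> (1 - \<alpha>) * q" "(1 - \<alpha>) * q \<le> (1 - \<alpha>) * (1 / 4)"
    using mult_left_mono[OF q(2), of "1 - \<alpha>"] alpha q by simp_all
  have lo: "1 + \<alpha> * (r - 1) / 2 \<le> \<tau> (n + 1)"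
    using \<tau>S aq IH(2) by (simp add: algebra_simps diff_divide_distrib add_divide_distrib)
  have step: "\<tau> (n + 1) \<le> \<tau> n + 1 / 2"
    using \<tau>S aq by (simp add: algebra_simps diff_divide_distrib)
  have hi: "\<tau> (n + 1) \<le> (r + 1) / 2" using step IH(3) by (simp add: add_divide_distrib)
  have \<tau>S1: "1 \<le> \<tau> (n + 1)" using \<tau>S \<tau>n aq alpha by linarith
  have nonneg: "0 \<le> \<tau> s" if "1 \<le> s" "s \<le> n + 1" for s
    using IH(1)[of s] \<tau>S1 that by (cases "s = n + 1") auto
  have LS: "0 \<le> L (n + 1)" using nonneg by (intro local_L_nonneg_if x_in_if) auto
  have E: "(3 + \<alpha> * (r - 2)) / (12 * Lh (n + 1)) \<le> \<eta> (n + 1)"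
  proof (rule order_trans[OF _ IH(4)])
    show "(3 + \<alpha> * (r - 2)) / (12 * Lh (n + 1)) \<le> (3 + \<alpha> * (r - 2)) / (12 * Lh n)"
      using ar Lh_pos[of n] Lh_pos[of "n+1"] Lh_mono[of n "n + 1"] by (intro divide_left_mono) auto
  qed
  \<comment> \<open>A term of the minimum that multiplies \<open>\<eta> (n + 1)\<close> by
    \<open>\<rho>\<close> preserves the bound once \<open>\<rho>\<close> covers the growth of the
    numerator. It is applied with 4/3 and with the ratio of the \<open>\<tau>\<close> terms.\<close>
  have E': "(3 + \<alpha> * (r - 1)) / (12 * Lh (n + 1)) \<le> \<rho> * \<eta> (n + 1)"
    if \<rho>: "3 + \<alpha> * (r - 1) \<le> \<rho> * (3 + \<alpha> * (r - 2))" "0 \<le> \<rho>" for \<rho>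
  proof -
    have "(3 + \<alpha> * (r - 1)) / (12 * Lh (n + 1)) \<le> \<rho> * (3 + \<alpha> * (r - 2)) / (12 * Lh (n + 1))"
      using \<rho> Lh_pos[of "n + 1"] by (intro divide_right_mono) auto
    also have "\<dots> \<le> \<rho> * \<eta> (n + 1)" using mult_left_mono[OF E \<rho>(2)] by simp
    finally show ?thesis .
  qed
  have "(3 + \<alpha> * (r - 1)) / (12 * Lh (n + 1)) \<le> \<eta> (n + 1 + 1)"
  proof (subst le_eta_iff_if, goal_cases)
    \<comment> \<open>Goals 1 to 3 are the side conditions of the equivalence; goal 4 consists of
      the three comparisons.\<close>
    case 4
    have 1: "(3 + \<alpha> * (r - 1)) / (12 * Lh (n + 1)) \<le> 4 / 3 * \<eta> (n + 1)"
      by (rule E') (use alpha ar in \<open>auto simp: algebra_simps\<close>)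
    have 2: "(3 + \<alpha> * (r - 1)) / (12 * Lh (n + 1)) \<le> (\<tau> n + 1) / \<tau> (n + 1) * \<eta> (n + 1)"
    proof (rule E')
      \<comment> \<open>As \<open>\<tau> n + 1\<close> is at least
        \<open>\<tau> (n + 1) + 1 / 2\<close>, the ratio condition reduces to
        \<open>\<alpha> * \<tau> (n + 1) \<le> (3 + \<alpha> * (r - 2)) / 2\<close>, which the upper
        bound on \<open>\<tau>\<close> and \<open>\<alpha> \<le> 1\<close> give.\<close>
      have "\<alpha> * \<tau> (n + 1) \<le> \<alpha> * ((r + 1) / 2)" using hi alpha by (intro mult_left_mono) auto
      also have "\<dots> \<le> (3 + \<alpha> * (r - 2)) / 2"
        using alpha by (simp add: algebra_simps add_divide_distrib diff_divide_distrib)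
      finally have 3: "\<tau> (n + 1) * (3 + \<alpha> * (r - 1)) \<le> (\<tau> (n + 1) + 1 / 2) * (3 + \<alpha> * (r - 2))"
        by (simp add: algebra_simps)
      have "\<dots> \<le> (\<tau> n + 1) * (3 + \<alpha> * (r - 2))"
        using step ar by (intro mult_right_mono) auto
      with 3 show "3 + \<alpha> * (r - 1) \<le> (\<tau> n + 1) / \<tau> (n + 1) * (3 + \<alpha> * (r - 2))"
        using \<tau>S1 by (simp add: field_simps)
    qed (use \<tau>n \<tau>S1 in auto)
    have "4 * ((3 + \<alpha> * (r - 1)) / (12 * Lh (n + 1))) * L (n + 1)
        = (3 + \<alpha> * (r - 1)) / 3 * (L (n + 1) / Lh (n + 1))"
      using Lh_pos[of "n + 1"] by (simp add: field_simps)
    also have "\<dots> \<le> (3 + \<alpha> * (r - 1)) / 3 * 1"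
      using L_le_Lh[of "n + 1"] Lh_pos[of "n + 1"] ar1 by (intro mult_left_mono) auto
    also have "\<dots> \<le> 1 + \<alpha> * (r - 1) / 2"
      using ar1 by simp
    also note lo
    finally show ?case using 1 2 by simp
  qed (use \<tau>S1 LS Suc.hyps in auto)
  with lo hi nonneg show ?case by (auto simp: r_def algebra_simps)
qed

lemma tau_nonneg: "1 \<le> t \<Longrightarrow> 0 \<le> \<tau> t"
  using parameter_bounds[of t] tau1 by (cases "t = 1") auto

lemma tau_lower: "2 \<le> t \<Longrightarrow> 1 + \<alpha> * (real t - 2) / 2 \<le> \<tau> t"
  using parameter_bounds by blast

lemma tau_ge_1: "1 \<le> \<tau> t" if "2 \<le> t"
proof -
  have "0 \<le> \<alpha> * (real t - 2) / 2" using alpha that by simp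
  with tau_lower[OF that] show ?thesis by linarith
qed

lemma x_in: "x t \<in> X"
  using x_in_if tau_nonneg by blast

lemma L_nonneg: "1 \<le> t \<Longrightarrow> 0 \<le> L t"
  using local_L_nonneg_if x_in by blast

lemma eta_lower: "(3 + \<alpha> * (real t - 2)) / (12 * Lh t) \<le> \<eta> (t + 1)" if "1 \<le> t"
proof (cases "t = 1")
  case True
  have "(3 - \<alpha>) / (12 * Lh 1) \<le> 3 / (12 * Lh 1)"
    using alpha Lh_pos[of 1] by (intro divide_right_mono) auto
  also have "\<dots> = 1 / (4 * Lh 1)" by simp
  also have "\<dots> \<le> \<eta> 2" by (rule eta2_ge) simp
  finally show ?thesis using True by (simp add: numeral_2_eq_2)
next
  case False
  then show ?thesis using parameter_bounds[of t] that by simp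
qed

lemma weight_pos: "0 < 3 + \<alpha> * (real t - 2)" if "1 \<le> t"
proof -
  have "\<alpha> * (-1) \<le> \<alpha> * (real t - 2)" using that alpha by (intro mult_left_mono) auto
  with alpha show ?thesis by linarith
qed

lemma eta_pos: "0 < \<eta> t" if "1 \<le> t"
proof (cases "t = 1")
  case False
  have "0 < (3 + \<alpha> * (real (t - 1) - 2)) / (12 * Lh (t - 1))"
    using False that weight_pos[of "t - 1"] Lh_pos by simp
  also have "\<dots> \<le> \<eta> t" using eta_lower[of "t - 1"] False that by simp
  finally show ?thesis .
qed (use eta1 in simp)

lemma
  assumes "3 \<le> t"
  shows eta_growth: "\<eta> t \<le> 4 / 3 * \<eta> (t - 1)"
    and eta_tau: "\<tau> (t - 1) * \<eta> t \<le> (\<tau> (t - 2) + 1) * \<eta> (t - 1)"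
    and eta_L: "4 * \<eta> t * L (t - 1) \<le> \<tau> (t - 1)"
proof -
  have \<tau>: "1 \<le> \<tau> (t - 1)" using assms by (intro tau_ge_1) auto
  have *: "\<eta> t \<le> 4 / 3 * \<eta> (t - 1) \<and> \<eta> t \<le> (\<tau> (t - 2) + 1) / \<tau> (t - 1) * \<eta> (t - 1)
    \<and> 4 * \<eta> t * L (t - 1) \<le> \<tau> (t - 1)"
    using le_eta_iff_if[of t "\<eta> t"] \<tau> L_nonneg[of "t - 1"] assms by simp
  then show "\<eta> t \<le> 4 / 3 * \<eta> (t - 1)" "4 * \<eta> t * L (t - 1) \<le> \<tau> (t - 1)" by auto
  from * \<tau> show "\<tau> (t - 1) * \<eta> t \<le> (\<tau> (t - 2) + 1) * \<eta> (t - 1)"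
    by (simp add: field_simps)
qed

section \<open>One step of the gap recursion\<close>

lemma z_eq: "z t = x t + \<tau> t *\<^sub>R (x t - x (t - 1))" if "1 \<le> t"
proof -
  have "(1 + \<tau> t) *\<^sub>R x t = z t + \<tau> t *\<^sub>R x (t - 1)"
    using tau_nonneg[OF that] by (subst x_eq[OF that]) simp
  then show ?thesis by (simp add: algebra_simps)
qed

text \<open>For \<open>h\<close>, use convexity at \<open>x t\<close> as a combination of
  \<open>z t\<close> and \<open>x (t - 1)\<close>. For \<open>f\<close>, split
  \<open>z t - xstar\<close> by \<open>z_eq\<close>: the part towards \<open>xstar\<close> uses the
  subgradient, the part along \<open>x t - x (t - 1)\<close> is exact and produces
  \<open>lin_gap\<close>.\<close>

lemma gap_le_linear:
  assumes "1 \<le> t"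
  shows "(1 + \<tau> t) * gap (x t) - \<tau> t * gap (x (t - 1)) + \<tau> t * lin_gap f g x t
    \<le> g (x t) \<bullet> (z t - xstar) + h (z t) - h xstar"
proof -
  have \<tau>: "0 \<le> \<tau> t" by (rule tau_nonneg[OF assms])
  have "x t = (1 / (1 + \<tau> t)) *\<^sub>R z t + (\<tau> t / (1 + \<tau> t)) *\<^sub>R x (t - 1)"
    using x_eq[OF assms] by (simp add: scaleR_add_right divide_inverse_commute)
  moreover have "1 - \<tau> t / (1 + \<tau> t) = 1 / (1 + \<tau> t)" using \<tau> by (simp add: field_simps)
  ultimately have "h (x t) \<le> 1 / (1 + \<tau> t) * h (z t) + \<tau> t / (1 + \<tau> t) * h (x (t - 1))"
    using convex_onD[OF h, of "\<tau> t / (1 + \<tau> t)" "z t" "x (t - 1)"] \<tau> z_in[OF assms] x_in by simp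
  then have "h (x t) \<le> (h (z t) + \<tau> t * h (x (t - 1))) / (1 + \<tau> t)"
    by (simp add: add_divide_distrib)
  then have h: "(1 + \<tau> t) * h (x t) \<le> h (z t) + \<tau> t * h (x (t - 1))"
    using \<tau> by (simp add: pos_le_divide_eq mult.commute)
  have f: "f (x t) - f xstar \<le> g (x t) \<bullet> (x t - xstar)"
    using subgrad[OF x_in, of t] xstar_in by (auto simp: subdifferential_def inner_diff_right)
  have "g (x t) \<bullet> (z t - xstar)
      = g (x t) \<bullet> (x t - xstar) + \<tau> t * (g (x t) \<bullet> (x t - x (t - 1)))"
    by (subst z_eq[OF assms]) (simp add: inner_add_right inner_diff_right algebra_simps)
  also have "g (x t) \<bullet> (x t - x (t - 1)) = f (x t) - f (x (t - 1)) + lin_gap f g x t"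
    by (simp add: lin_gap_def inner_diff_right)
  finally show ?thesis using h f by (simp add: algebra_simps)
qed

lemma one_step:
  fixes t
  defines "c \<equiv> \<eta> (t + 1) / (\<eta> t * (1 - \<beta>s t))"
    and "u \<equiv> z (t + 1) - y t" and "v \<equiv> z t - y t"
  assumes t: "1 \<le> t"
  shows "\<eta> (t + 1) * ((1 + \<tau> t) * gap (x t) - \<tau> t * gap (x (t - 1)))
      + \<eta> (t + 1) * \<tau> t * lin_gap f g x t
      + \<eta> (t + 1) * ((g (x t) - g (x (t - 1))) \<bullet> (u - v))
    \<le> 1 / (2 * \<beta>) * (norm (y t - xstar))\<^sup>2 - 1 / (2 * \<beta>) * (norm (y (t + 1) - xstar))\<^sup>2
      - ((1 - \<beta> / 2) * (norm u)\<^sup>2 - c * (u \<bullet> v) + c * (norm v)\<^sup>2)"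
proof -
  have \<eta>: "0 < \<eta> t" "0 < \<eta> (t + 1)" using eta_pos t by auto
  have bt: "0 < 1 - \<beta>s t" using beta1 betas[of t] beta t by (cases "t = 1") auto
  have "\<eta> (t + 1) * (g (x t) \<bullet> (z (t + 1) - xstar) + h (z (t + 1)) - h xstar)
      \<le> (y t - z (t + 1)) \<bullet> (z (t + 1) - xstar)"
    using prox_optimality[OF h _ z_argmin[of "t + 1"] xstar_in] \<eta> by simp
  also have "\<dots> = 1 / (2 * \<beta>) * (norm (y t - xstar))\<^sup>2
      - 1 / (2 * \<beta>) * (norm (y (t + 1) - xstar))\<^sup>2 - (1 - \<beta> / 2) * (norm u)\<^sup>2"
    using prox_averaging_identity[OF beta(1), of "y t" "z (t + 1)" xstar]
      y_eq[of "t + 1"] betas[of "t + 1"] t by (simp add: u_def)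
  finally have 1: "\<eta> (t + 1) * (g (x t) \<bullet> (z (t + 1) - xstar) + h (z (t + 1)) - h xstar)
    \<le> 1 / (2 * \<beta>) * (norm (y t - xstar))\<^sup>2
      - 1 / (2 * \<beta>) * (norm (y (t + 1) - xstar))\<^sup>2 - (1 - \<beta> / 2) * (norm u)\<^sup>2" .
  have "\<eta> t * (g (x (t - 1)) \<bullet> (z t - z (t + 1)) + h (z t) - h (z (t + 1)))
      \<le> (y (t - 1) - z t) \<bullet> (z t - z (t + 1))"
    using prox_optimality[OF h _ z_argmin[OF t] z_in[of "t + 1"]] \<eta> by simp
  \<comment> \<open>The point \<open>y t\<close> lies at fraction \<open>\<beta>s t\<close> of the
    way from \<open>y (t - 1)\<close> to \<open>z t\<close>; this is the source of
    \<open>1 - \<beta>s t\<close> in the denominator of \<open>c\<close>.\<close>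
  also have "y (t - 1) - z t = - ((1 / (1 - \<beta>s t)) *\<^sub>R v)"
  proof -
    have "v = (1 - \<beta>s t) *\<^sub>R (z t - y (t - 1))"
      unfolding v_def by (subst y_eq[OF t]) (simp add: algebra_simps)
    then show ?thesis using bt by simp
  qed
  also have "z t - z (t + 1) = v - u" by (simp add: u_def v_def)
  finally have "\<eta> (t + 1) / \<eta> t
      * (\<eta> t * (g (x (t - 1)) \<bullet> (v - u) + h (z t) - h (z (t + 1))))
      \<le> \<eta> (t + 1) / \<eta> t * (- ((1 / (1 - \<beta>s t)) *\<^sub>R v) \<bullet> (v - u))"
    using \<eta> by (intro mult_left_mono) auto
  also have "\<dots> = c * (u \<bullet> v - v \<bullet> v)"
    by (simp add: c_def inner_diff_right inner_commute right_diff_distrib diff_divide_distrib)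
  finally have 2: "\<eta> (t + 1) * (g (x (t - 1)) \<bullet> (v - u) + h (z t) - h (z (t + 1)))
      \<le> c * (u \<bullet> v) - c * (norm v)\<^sup>2"
    using \<eta> by (simp add: power2_norm_eq_inner right_diff_distrib)
  have "\<eta> (t + 1) * ((1 + \<tau> t) * gap (x t) - \<tau> t * gap (x (t - 1)) + \<tau> t * lin_gap f g x t)
      \<le> \<eta> (t + 1) * (g (x t) \<bullet> (z t - xstar) + h (z t) - h xstar)"
    using gap_le_linear[OF t] \<eta> by (intro mult_left_mono) auto
  \<comment> \<open>Since \<open>u - v = z (t + 1) - z t\<close>, adding the gradient difference on
    both sides moves the linear term from \<open>z t\<close> to \<open>z (t + 1)\<close>; what
    remains involves \<open>g (x (t - 1))\<close> and is the left side of the second optimality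
    condition.\<close>
  also have "\<dots> + \<eta> (t + 1) * ((g (x t) - g (x (t - 1))) \<bullet> (u - v))
      = \<eta> (t + 1) * (g (x t) \<bullet> (z (t + 1) - xstar) + h (z (t + 1)) - h xstar)
      + \<eta> (t + 1) * (g (x (t - 1)) \<bullet> (v - u) + h (z t) - h (z (t + 1)))"
    by (simp add: u_def v_def inner_diff_left inner_diff_right algebra_simps)
  finally show ?thesis using 1 2 by (simp add: algebra_simps)
qed

section \<open>Potential and telescoping\<close>

definition potential :: "nat \<Rightarrow> real" where
  "potential t = 1 / (2 * \<beta>) * (norm (y t - xstar))\<^sup>2 + 1 / 4 * (norm (z t - y (t - 1)))\<^sup>2"

text \<open>The second summand is twice what the first step leaves unabsorbed.\<close>

definition bound :: real where
  "bound = 1 / \<beta> * (norm (z 0 - xstar))\<^sup>2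
    + \<eta> 2 * (5 * L 1 / 2 - 1 / \<eta> 1) * (norm (z 1 - z 0))\<^sup>2"

text \<open>Because \<open>\<tau> 1 = 0\<close>, no \<open>lin_gap\<close> term is available to
  absorb the gradient error, so the Lipschitz quotient \<open>L 1\<close> takes its place.\<close>

lemma first_step: "\<eta> 2 * gap (x 1) \<le> bound / 2 - potential 2"
proof -
  define u v d where "u = z 2 - y 1" and "v = z 1 - y 1" and "d = g (x 1) - g (x 0)"
  have y1: "y 1 = z 0" using y_eq[of 1] beta1 init by simp
  have x1: "x 1 = z 1" using x_eq[of 1] tau1 by simp
  have two: "(1::nat) + 1 = 2" by simp
  have "\<eta> 2 \<le> (1 - \<beta>) * \<eta> 1" "4 * \<eta> 2 * L 1 \<le> 1" using le_eta2_iff[of "\<eta> 2"] by auto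
  moreover have "0 < \<eta> 2" "0 < \<eta> 1" using eta_pos by auto
  moreover have "norm d \<le> L 1 * norm v"
    using eta1 x1 y1 init by (simp add: local_L_def d_def v_def)
  ultimately have "1 / 4 * (norm u)\<^sup>2 - \<eta> 2 * (d \<bullet> (u - v))
      + \<eta> 2 / \<eta> 1 / 2 * (norm v)\<^sup>2 - 5 / 4 * \<eta> 2 * L 1 * (norm v)\<^sup>2
    \<le> (1 - \<beta> / 2) * (norm u)\<^sup>2 - \<eta> 2 / \<eta> 1 * (u \<bullet> v) + \<eta> 2 / \<eta> 1 * (norm v)\<^sup>2"
    using L_nonneg[of 1] by (intro potential_first_step) (auto simp: field_simps)
  moreover have "\<eta> 2 * gap (x 1) + \<eta> 2 * (d \<bullet> (u - v))
    \<le> 1 / (2 * \<beta>) * (norm (z 0 - xstar))\<^sup>2 - 1 / (2 * \<beta>) * (norm (y 2 - xstar))\<^sup>2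
      - ((1 - \<beta> / 2) * (norm u)\<^sup>2 - \<eta> 2 / \<eta> 1 * (u \<bullet> v) + \<eta> 2 / \<eta> 1 * (norm v)\<^sup>2)"
    using one_step[of 1] unfolding two beta1 tau1 u_def v_def d_def y1 by simp
  moreover have "bound / 2 = 1 / (2 * \<beta>) * (norm (z 0 - xstar))\<^sup>2
      + 5 / 4 * \<eta> 2 * L 1 * (norm v)\<^sup>2 - \<eta> 2 / \<eta> 1 / 2 * (norm v)\<^sup>2"
    unfolding v_def y1 by (simp add: bound_def algebra_simps diff_divide_distrib add_divide_distrib)
  moreover have "potential 2
      = 1 / (2 * \<beta>) * (norm (y 2 - xstar))\<^sup>2 + 1 / 4 * (norm u)\<^sup>2"
    by (simp add: potential_def u_def)
  ultimately show ?thesis by linarith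
qed

lemma later_step:
  assumes t: "2 \<le> t"
  shows "\<eta> (t + 1) * ((1 + \<tau> t) * gap (x t) - \<tau> t * gap (x (t - 1)))
    \<le> potential t - potential (t + 1)"
proof -
  define u v c where "u = z (t + 1) - y t" and "v = z t - y t"
    and "c = \<eta> (t + 1) / (\<eta> t * (1 - \<beta>s t))"
  have \<eta>: "0 < \<eta> t" "0 < \<eta> (t + 1)" using eta_pos t by auto
  \<comment> \<open>The growth factor 4/3 is below 3/2, which is at most
    \<open>2 * (1 - \<beta>)\<close>; hence \<open>c \<le> 2\<close>.\<close>
  have "\<eta> (t + 1) \<le> 4 / 3 * \<eta> t" using eta_growth[of "t + 1"] t by simp
  moreover have "2 * (3 / 4) * \<eta> t \<le> 2 * (1 - \<beta>) * \<eta> t"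
    using beta \<eta> by (intro mult_right_mono) auto
  ultimately have "\<eta> (t + 1) \<le> 2 * (\<eta> t * (1 - \<beta>))" using \<eta> by (simp add: algebra_simps)
  then have c: "0 \<le> c" "c \<le> 2"
    using \<eta> beta betas[OF t] by (auto simp: c_def divide_le_eq)
  have "- (\<eta> (t + 1) * ((g (x t) - g (x (t - 1))) \<bullet> (u - v)))
      \<le> \<eta> (t + 1) * \<tau> t * lin_gap f g x t + (norm (u - v))\<^sup>2 / 8"
    using local_L_gap_if[OF t x_in x_in] \<eta> eta_L[of "t + 1"] t
    by (intro gradient_error_bound[where l = "L t"]) auto
  moreover have "(norm v)\<^sup>2 \<le> (norm (z t - y (t - 1)))\<^sup>2"
  proof -
    have "v = (1 - \<beta>) *\<^sub>R (z t - y (t - 1))"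
      unfolding v_def using y_eq[of t] betas[OF t] t by (simp add: algebra_simps)
    then have "norm v = (1 - \<beta>) * norm (z t - y (t - 1))" using beta by simp
    also have "\<dots> \<le> norm (z t - y (t - 1))" using beta by (intro mult_left_le_one_le) auto
    finally show ?thesis by (intro power_mono) auto
  qed
  moreover have "potential (t + 1)
      = 1 / (2 * \<beta>) * (norm (y (t + 1) - xstar))\<^sup>2 + 1 / 4 * (norm u)\<^sup>2"
    by (simp add: potential_def u_def)
  moreover have "1 \<le> t" using t by simp
  ultimately show ?thesis
    using potential_step[OF c beta(2), of u v] one_step[of t, folded u_def v_def c_def]
      potential_def[of t]
    by linarith
qed

lemma sum_steps_le:
  assumes "1 \<le> k"
  shows "(\<Sum>t = 1..k. \<eta> (t + 1) * ((1 + \<tau> t) * gap (x t) - \<tau> t * gap (x (t - 1))))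
    \<le> bound / 2 - potential (k + 1)"
  using assms
proof (induction k rule: nat_induct_at_least)
  case base
  show ?case using first_step tau1 by (simp add: numeral_2_eq_2)
next
  case (Suc n)
  then show ?case using later_step[of "Suc n"] by simp
qed

section \<open>Summation by parts and weights of the average\<close>

definition wt :: "nat \<Rightarrow> real" where
  "wt t = (\<tau> t + 1) * \<eta> (t + 1) - \<tau> (t + 1) * \<eta> (t + 2)"

text \<open>This is the purpose of the ratio term in the minimum defining the step sizes.\<close>

lemma wt_nonneg: "1 \<le> t \<Longrightarrow> 0 \<le> wt t"
  using eta_tau[of "t + 2"] by (simp add: wt_def)

lemma last_wt_nonneg: "1 \<le> k \<Longrightarrow> 0 \<le> (\<tau> k + 1) * \<eta> (k + 1)"
  using tau_nonneg[of k] eta_pos[of "k + 1"] by simp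

text \<open>Abel summation, with \<open>\<tau> 1 = 0\<close> removing \<open>d 0\<close>. The
  sequence \<open>d\<close> is arbitrary: the constant 1 gives the total weight and the gaps give
  the weighted bound.\<close>

lemma sum_by_parts:
  fixes d :: "nat \<Rightarrow> real"
  assumes "1 \<le> k"
  shows "(\<Sum>t = 1..k - 1. wt t * d t) + (\<tau> k + 1) * \<eta> (k + 1) * d k
    = (\<Sum>t = 1..k. \<eta> (t + 1) * ((1 + \<tau> t) * d t - \<tau> t * d (t - 1)))"
  using assms
proof (induction k rule: nat_induct_at_least)
  case base
  show ?case using tau1 by simp
next
  case (Suc n)
  obtain m where m: "n = Suc m" using Suc.hyps by (cases n) auto
  show ?case using Suc.IH by (simp add: m wt_def algebra_simps)
qed

lemma sum_wt:
  assumes "1 \<le> k"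
  shows "(\<Sum>t = 1..k - 1. wt t) + (\<tau> k + 1) * \<eta> (k + 1) = (\<Sum>t = 2..k + 1. \<eta> t)"
proof -
  have "(\<Sum>t = 2..k + 1. \<eta> t) = (\<Sum>t = 1..k. \<eta> (t + 1))"
    using sum.shift_bounds_cl_nat_ivl[of \<eta> 1 1 k] by (simp add: numeral_2_eq_2)
  with sum_by_parts[OF assms, of "\<lambda>_. 1"] show ?thesis by (simp add: algebra_simps)
qed

lemma weighted_gaps_le:
  assumes "1 \<le> k"
  shows "(\<Sum>t = 1..k - 1. wt t * gap (x t)) + (\<tau> k + 1) * \<eta> (k + 1) * gap (x k) \<le> bound / 2"
proof -
  have "0 \<le> potential (k + 1)" using beta by (simp add: potential_def)
  with sum_steps_le[OF assms] sum_by_parts[OF assms, of "\<lambda>t. gap (x t)"]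
  show ?thesis by linarith
qed

section \<open>Convergence rates\<close>

text \<open>All weighted gaps are nonnegative, so the last one alone is at most
  \<open>bound / 2\<close>, and its weight is bounded below by \<open>tau_lower\<close> and
  \<open>eta_lower\<close>. The former starts at index 2, since \<open>\<tau> 1 = 0\<close>.\<close>

lemma last_gap_le:
  assumes k: "2 \<le> k"
  shows "gap (x k)
    \<le> 12 * Lh k / ((\<alpha> * real k + 4 - 2 * \<alpha>) * (\<alpha> * real k + 3 - 2 * \<alpha>)) * bound"
proof -
  define A where "A = \<alpha> * (real k - 2)"
  have A: "0 \<le> A" using alpha k by (simp add: A_def)
  have "(4 + A) / 2 * ((3 + A) / (12 * Lh k)) \<le> (\<tau> k + 1) * \<eta> (k + 1)"
    using eta_lower[of k] tau_lower[OF k] k A Lh_pos[of k] tau_nonneg[of k]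
    by (intro mult_mono) (auto simp: A_def)
  then have "(4 + A) / 2 * ((3 + A) / (12 * Lh k)) * gap (x k) \<le> (\<tau> k + 1) * \<eta> (k + 1) * gap (x k)"
    using gap_nonneg[OF x_in] by (intro mult_right_mono)
  also have "\<dots> \<le> bound / 2"
  proof -
    have "0 \<le> (\<Sum>t = 1..k - 1. wt t * gap (x t))"
      using wt_nonneg gap_nonneg[OF x_in] by (intro sum_nonneg mult_nonneg_nonneg) auto
    with weighted_gaps_le[of k] k show ?thesis by linarith
  qed
  finally have "(4 + A) * (3 + A) * gap (x k) \<le> 12 * Lh k * bound"
    using Lh_pos[of k] by (simp add: pos_divide_le_eq mult.commute mult.left_commute)
  then have "gap (x k) \<le> 12 * Lh k / ((4 + A) * (3 + A)) * bound"
    using A by (simp add: pos_le_divide_eq mult.commute)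
  then show ?thesis by (simp add: A_def algebra_simps)
qed

lemma x_bar_gap:
  assumes k: "1 \<le> k"
  shows "x_bar \<eta> \<tau> x k \<in> X" and "(\<Sum>t = 2..k + 1. \<eta> t) * gap (x_bar \<eta> \<tau> x k) \<le> bound / 2"
proof -
  define S where "S = (\<Sum>t = 2..k + 1. \<eta> t)"
  define w where "w t = (if t = k then (\<tau> k + 1) * \<eta> (k + 1) else wt t)" for t
  \<comment> \<open>The value type of \<open>F\<close> is left open because the splitting serves
    both real sums and vector sums.\<close>
  have split: "(\<Sum>t = 1..k. F t (w t)) = (\<Sum>t = 1..k - 1. F t (wt t)) + F k ((\<tau> k + 1) * \<eta> (k + 1))"
    for F :: "nat \<Rightarrow> real \<Rightarrow> 'b::comm_monoid_add"
  proof -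
    obtain m where m: "k = Suc m" using k by (cases k) auto
    show ?thesis by (simp add: m w_def)
  qed
  have S: "0 < S" unfolding S_def using k eta_pos by (intro sum_pos) auto
  have w: "0 \<le> w t / S" if "t \<in> {1..k}" for t
    using wt_nonneg[of t] last_wt_nonneg[OF k] S that by (auto simp: w_def)
  have "(\<Sum>t = 1..k. w t) = S" using split[of "\<lambda>_ r. r"] sum_wt[OF k] by (simp add: S_def)
  then have w1: "(\<Sum>t = 1..k. w t / S) = 1" using S by (simp flip: sum_divide_distrib)
  have "x_bar \<eta> \<tau> x k = (\<Sum>t = 1..k. w t *\<^sub>R x t) /\<^sub>R S"
    unfolding x_bar_def S_def using split[of "\<lambda>t r. r *\<^sub>R x t"] by (simp add: wt_def)
  then have xb: "x_bar \<eta> \<tau> x k = (\<Sum>t = 1..k. (w t / S) *\<^sub>R x t)"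
    by (simp add: scaleR_sum_right divide_inverse_commute)
  show "x_bar \<eta> \<tau> x k \<in> X"
    unfolding xb using w w1 x_in by (intro convex_sum X) auto
  have fh: "convex_on X (\<lambda>u. f u + h u)" using f h by (rule convex_on_add)
  have "f (x_bar \<eta> \<tau> x k) + h (x_bar \<eta> \<tau> x k) \<le> (\<Sum>t = 1..k. w t / S * (f (x t) + h (x t)))"
    unfolding xb using k w w1 x_in by (intro convex_on_sum[OF _ _ fh]) auto
  also have "\<dots> = (\<Sum>t = 1..k. w t / S * gap (x t)) + (f xstar + h xstar)"
    unfolding right_diff_distrib sum_subtractf sum_distrib_right[symmetric] w1 by simp
  finally have "gap (x_bar \<eta> \<tau> x k) \<le> (\<Sum>t = 1..k. w t * gap (x t)) / S"
    by (simp add: sum_divide_distrib)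
  then have "S * gap (x_bar \<eta> \<tau> x k) \<le> (\<Sum>t = 1..k. w t * gap (x t))"
    using S by (simp add: field_simps)
  also have "\<dots> \<le> bound / 2"
    using weighted_gaps_le[OF k] split[of "\<lambda>t r. r * gap (x t)"] by simp
  finally show "(\<Sum>t = 2..k + 1. \<eta> t) * gap (x_bar \<eta> \<tau> x k) \<le> bound / 2"
    by (simp add: S_def)
qed

text \<open>The sign is not visible in the formula, where \<open>5 * L 1 / 2 - 1 / \<eta> 1\<close>
  can be negative; it follows because \<open>bound / 2\<close> dominates a nonnegative gap at
  \<open>k = 1\<close>.\<close>

lemma bound_nonneg: "0 \<le> bound"
proof -
  have "0 \<le> (\<Sum>t = 2..1 + 1. \<eta> t) * gap (x_bar \<eta> \<tau> x 1)"
    using gap_nonneg[OF x_bar_gap(1)[of 1]]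
    by (intro mult_nonneg_nonneg sum_nonneg less_imp_le[OF eta_pos]) auto
  with x_bar_gap(2)[of 1] show ?thesis by simp
qed

text \<open>Summing \<open>eta_lower\<close> bounds the total step size below by one twelfth of the
  denominator; dividing \<open>bound / 2\<close> by it gives the constant 6.\<close>

lemma average_gap_le:
  assumes k: "1 \<le> k"
  shows "gap (x_bar \<eta> \<tau> x k) \<le> 6 / (\<Sum>t = 1..k. (3 + \<alpha> * (real t - 2)) / Lh t) * bound"
proof -
  define S where "S = (\<Sum>t = 1..k. (3 + \<alpha> * (real t - 2)) / Lh t)"
  have S: "0 < S"
    unfolding S_def using k weight_pos Lh_pos by (intro sum_pos) auto
  have "S / 12 = (\<Sum>t = 1..k. (3 + \<alpha> * (real t - 2)) / (12 * Lh t))"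
    by (simp add: S_def sum_divide_distrib mult.commute)
  also have "\<dots> \<le> (\<Sum>t = 1..k. \<eta> (t + 1))"
    by (intro sum_mono eta_lower) auto
  also have "\<dots> = (\<Sum>t = 2..k + 1. \<eta> t)"
    using sum.shift_bounds_cl_nat_ivl[of \<eta> 1 1 k] by (simp add: numeral_2_eq_2)
  finally have "S / 12 * gap (x_bar \<eta> \<tau> x k) \<le> (\<Sum>t = 2..k + 1. \<eta> t) * gap (x_bar \<eta> \<tau> x k)"
    using gap_nonneg[OF x_bar_gap(1)[OF k]] by (intro mult_right_mono)
  also have "\<dots> \<le> bound / 2" by (rule x_bar_gap(2)[OF k])
  finally show ?thesis
    unfolding S_def[symmetric] using S by (simp add: field_simps)
qed

text \<open>Monotonicity of \<open>Lh\<close> allows \<open>Lh k\<close> in every summand, after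
  which an arithmetic series remains.\<close>

lemma average_rate_le:
  assumes k: "1 \<le> k"
  shows "6 / (\<Sum>t = 1..k. (3 + \<alpha> * (real t - 2)) / Lh t) * bound
    \<le> 12 * Lh k / (6 * real k + \<alpha> * real k * (real k - 3)) * bound"
proof -
  define T where "T = (\<Sum>t = 1..k. 3 + \<alpha> * (real t - 2))"
  have T: "0 < T" unfolding T_def using k weight_pos by (intro sum_pos) auto
  have T_eq: "6 * real n + \<alpha> * real n * (real n - 3) = 2 * (\<Sum>t = 1..n. 3 + \<alpha> * (real t - 2))" for n
    by (induction n) (simp_all add: algebra_simps)
  have "T / Lh k = (\<Sum>t = 1..k. (3 + \<alpha> * (real t - 2)) / Lh k)"
    by (simp add: T_def sum_divide_distrib)
  also have "\<dots> \<le> (\<Sum>t = 1..k. (3 + \<alpha> * (real t - 2)) / Lh t)"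
  proof (intro sum_mono divide_left_mono)
    fix t assume "t \<in> {1..k}"
    then show "Lh t \<le> Lh k" "0 \<le> 3 + \<alpha> * (real t - 2)" "0 < Lh k * Lh t"
      using Lh_mono[of t k] weight_pos[of t] Lh_pos by auto
  qed
  finally have "6 / (\<Sum>t = 1..k. (3 + \<alpha> * (real t - 2)) / Lh t) \<le> 6 / (T / Lh k)"
    using T Lh_pos[of k] by (intro divide_left_mono mult_pos_pos)
      (auto intro: less_le_trans[of 0 "T / Lh k"])
  also have "\<dots> = 12 * Lh k / (6 * real k + \<alpha> * real k * (real k - 3))"
    unfolding T_eq T_def[symmetric] by simp
  finally show ?thesis using bound_nonneg by (intro mult_right_mono)
qed

end

theorem corollary2:
  fixes X :: "'a::euclidean_space set"
    and f h \<Psi> :: "'a \<Rightarrow> real" and g :: "'a \<Rightarrow> 'a"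
    and z y x :: "nat \<Rightarrow> 'a" and \<eta> \<beta>s \<tau> L Lh :: "nat \<Rightarrow> real"
    and \<alpha> \<beta> R :: real and xstar :: 'a and k :: nat
  assumes X: "closed X" "convex X"
    and f: "closed_convex_on X f" and h: "closed_convex_on X h"
    and Psi: "\<Psi> = (\<lambda>u. f u + h u)"
    and xstar: "xstar \<in> minimizers X \<Psi>"
    and subgrad: "\<forall>u\<in>X. g u \<in> subdifferential X f u"
    and smooth: "\<exists>M>0. oracle_smooth X f g M"
    and run: "ac_fgm X h g \<eta> \<beta>s \<tau> z y x"
    and alpha: "0 \<le> \<alpha>" "\<alpha> \<le> 1"
    and beta: "0 < \<beta>" "\<beta> \<le> 1 - sqrt 6 / 3"
    and eta1: "\<eta> 1 > 0" "x 1 \<noteq> x 0"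
    and L: "L = local_L f g x"
    and params: "ac_fgm_params \<alpha> \<beta> L \<eta> \<beta>s \<tau>"
    and Lh: "Lh = L_hat \<beta> \<eta> L"
    and R: "R = 1 / \<beta> * (norm (z 0 - xstar))\<^sup>2
                 + \<eta> 2 * (5 * L 1 / 2 - 1 / \<eta> 1) * (norm (z 1 - z 0))\<^sup>2"
    and k: "k \<ge> 1"
  shows "(k \<ge> 2 \<longrightarrow>
            \<Psi> (x k) - \<Psi> xstar
              \<le> 12 * Lh k / ((\<alpha> * real k + 4 - 2 * \<alpha>) * (\<alpha> * real k + 3 - 2 * \<alpha>)) * R)
       \<and> \<Psi> (x_bar \<eta> \<tau> x k) - \<Psi> xstar
           \<le> 6 / (\<Sum>t = 1..k. (3 + \<alpha> * (real t - 2)) / Lh t) * R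
       \<and> 6 / (\<Sum>t = 1..k. (3 + \<alpha> * (real t - 2)) / Lh t) * R
           \<le> 12 * Lh k / (6 * real k + \<alpha> * real k * (real k - 3)) * R"
proof -
  obtain M where M: "M > 0" "oracle_smooth X f g M" using smooth by blast
  \<comment> \<open>This turns \<open>1 - sqrt 6 / 3\<close> into the rational bound 1/4 with which
    the quadratic estimates work.\<close>
  have "9 / 4 \<le> sqrt 6" by (rule real_le_rsqrt) (simp add: power2_eq_square)
  then have "\<beta> \<le> 1 / 4" using beta by simp
  then interpret ac_fgm_run X f h g z y x \<eta> \<beta>s \<tau> \<alpha> \<beta> M xstar
    using X f h xstar subgrad M run alpha beta eta1 params
    by unfold_locales (auto simp: closed_convex_on_def Psi L)
  have "R = bound" by (simp add: R L bound_def)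
  then show ?thesis
    using last_gap_le[of k] average_gap_le[OF k] average_rate_le[OF k]
    by (auto simp: Psi Lh L)
qed

end
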